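(* Let $n\mid(q+1)$, let $\delta\ge3$ be odd, and let $b,s,m$ be positive integers with $\gcd(b,n)=1$. Let $t\in\{0,\dots,n-1\}$ and let $i_1<\dots<i_s$ be integers with $m-1+\delta\le i_1$, $i_s\le n-\delta$ and $i_{\ell+1}-i_\ell\ge\delta$ for $\ell=1,\dots,s-1$. Put $$A=\{\alpha^{t},\alpha^{t+b},\dots,\alpha^{t+(m-1)b},\alpha^{t+i_1b},\dots,\alpha^{t+i_sb}\},\qquad B=\{\alpha^{jb}: -\tfrac{\delta-3}{2}\le j\le\tfrac{\delta-1}{2}\}.$$ Suppose $\{j:\alpha^j\in AB\}$ is a union of $q$-cyclotomic cosets modulo $n$. Let $d_A^{\perp}$ be the minimum distance of the dual of the cyclic code of length $n$ over $\mathbb{F}_{q^2}$ with complete defining set $A$. Then $C_{AB}$ is a cyclic $(d_A^{\perp}-\delta+1,\delta)$-LRC of length $n$ over $\mathbb{F}_q$ with dimension $k=n-m+1-(s+1)(\delta-1)$. Moreover, if $\lceil k/r\rceil=s+1$ where $r=d_A^{\perp}-\delta+1$, then $C_{AB}$ is an optimal $(r,\delta)$-LRC with minimum distance $m+\delta-1$.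
   Context: Let $q$ be a prime power and $n\mid(q+1)$, so the set $R_n$ of all $n$-th roots of unity lies in $\mathbb{F}_{q^2}$; let $\alpha\in\mathbb{F}_{q^2}$ be a primitive $n$-th root of unity. For $A,B\subseteq R_n$, $AB=\{\beta\gamma:\beta\in A,\gamma\in B\}$. For $Z\subseteq R_n$, the cyclic code of length $n$ over $\mathbb{F}_{q^2}$ with complete defining set $Z$ is the ideal generated by $\prod_{\beta\in Z}(x-\beta)$ in $\mathbb{F}_{q^2}[x]/(x^n-1)$; if $\{j:\alpha^j\in Z\}$ is a union of $q$-cyclotomic cosets modulo $n$ (equivalently here, closed under $j\mapsto -j \bmod n$), this polynomial lies in $\mathbb{F}_q[x]$ and $C_Z$ denotes the cyclic code of length $n$ over $\mathbb{F}_q$ it generates (dimension $n-|Z|$). Locality: for a linear code $C\subseteq\mathbb{F}_q^n$ and integers $r\ge1$, $\delta\ge2$, the $i$-th coordinate has $(r,\delta)$-locality if there is $S_i\subseteq\{1,\dots,n\}$ with $i\in S_i$, $|S_i|\le r+\delta-1$ such that the punctured code $C|_{S_i}$ has minimum distance at least $\delta$; $C$ is an $(r,\delta)$-LRC if every coordinate has $(r,\delta)$-locality. An $[n,k,d]$ $(r,\delta)$-LRC is optimal if $d=n-k-(\lceil k/r\rceil-1)(\delta-1)+1$ (always an upper bound on $d$). *)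

theory Defs
  imports Complex_Main "HOL-Computational_Algebra.Polynomial"
begin

text \<open>Ambient field: a finite field type 'a of order q^2 (playing the role of F_{q^2}).
  The subfield F_q is the set of fixed points of the q-Frobenius.
  Words of length n are functions nat => 'a, coordinates 0..n-1, zero elsewhere.\<close>

definition subfield_Fq :: "nat \<Rightarrow> 'a::field set" where
  "subfield_Fq q = {x. x ^ q = x}"

definition prime_power :: "nat \<Rightarrow> bool" where
  "prime_power q \<longleftrightarrow> (\<exists>p e. prime p \<and> e \<ge> 1 \<and> q = p ^ e)"

definition primitive_root_of_unity :: "nat \<Rightarrow> 'a::field \<Rightarrow> bool" where
  "primitive_root_of_unity n a \<longleftrightarrow> a ^ n = 1 \<and> (\<forall>j. 0 < j \<and> j < n \<longrightarrow> a ^ j \<noteq> 1)"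

definition setprod :: "'a::times set \<Rightarrow> 'a set \<Rightarrow> 'a set" where
  "setprod A B = {x * y | x y. x \<in> A \<and> y \<in> B}"

definition union_of_cyclotomic_cosets :: "nat \<Rightarrow> nat \<Rightarrow> 'a::field \<Rightarrow> 'a set \<Rightarrow> bool" where
  "union_of_cyclotomic_cosets q n a Z \<longleftrightarrow>
     (\<forall>j<n. a ^ j \<in> Z \<longrightarrow> a ^ ((q * j) mod n) \<in> Z)"

definition gen_poly :: "'a::field set \<Rightarrow> 'a poly" where
  "gen_poly Z = (\<Prod>\<beta>\<in>Z. [:- \<beta>, 1:])"

definition xn_minus_1 :: "nat \<Rightarrow> 'a::field poly" where
  "xn_minus_1 n = monom 1 n - 1"

definition poly_word :: "nat \<Rightarrow> 'a::zero poly \<Rightarrow> nat \<Rightarrow> 'a" where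
  "poly_word n c = (\<lambda>i. if i < n then coeff c i else 0)"

definition cyclic_code_big :: "nat \<Rightarrow> 'a::field set \<Rightarrow> (nat \<Rightarrow> 'a) set" where
  "cyclic_code_big n Z = {poly_word n ((f * gen_poly Z) mod xn_minus_1 n) | f. True}"

definition cyclic_code_Fq :: "nat \<Rightarrow> nat \<Rightarrow> 'a::field set \<Rightarrow> (nat \<Rightarrow> 'a) set" where
  "cyclic_code_Fq q n Z = {poly_word n ((f * gen_poly Z) mod xn_minus_1 n) | f.
       \<forall>i. coeff f i \<in> subfield_Fq q}"

definition dual_code :: "nat \<Rightarrow> (nat \<Rightarrow> 'a::field) set \<Rightarrow> (nat \<Rightarrow> 'a) set" where
  "dual_code n C = {v. (\<forall>i\<ge>n. v i = 0) \<and> (\<forall>c\<in>C. (\<Sum>i<n. v i * c i) = 0)}"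

definition hamming_dist :: "nat \<Rightarrow> (nat \<Rightarrow> 'a) \<Rightarrow> (nat \<Rightarrow> 'a) \<Rightarrow> nat" where
  "hamming_dist n x y = card {i. i < n \<and> x i \<noteq> y i}"

definition min_dist :: "nat \<Rightarrow> (nat \<Rightarrow> 'a) set \<Rightarrow> nat" where
  "min_dist n C = Min {hamming_dist n x y | x y. x \<in> C \<and> y \<in> C \<and> x \<noteq> y}"

definition puncture :: "(nat \<Rightarrow> 'a::zero) \<Rightarrow> nat set \<Rightarrow> nat \<Rightarrow> 'a" where
  "puncture c S = (\<lambda>i. if i \<in> S then c i else 0)"

definition has_locality :: "nat \<Rightarrow> (nat \<Rightarrow> 'a::zero) set \<Rightarrow> int \<Rightarrow> nat \<Rightarrow> nat \<Rightarrow> bool" where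
  "has_locality n C r \<delta> i \<longleftrightarrow>
     (\<exists>S. S \<subseteq> {..<n} \<and> i \<in> S \<and> int (card S) \<le> r + int \<delta> - 1 \<and>
        (\<forall>x\<in>C. \<forall>y\<in>C. puncture x S \<noteq> puncture y S \<longrightarrow>
             hamming_dist n (puncture x S) (puncture y S) \<ge> \<delta>))"

definition is_LRC :: "nat \<Rightarrow> (nat \<Rightarrow> 'a::zero) set \<Rightarrow> int \<Rightarrow> nat \<Rightarrow> bool" where
  "is_LRC n C r \<delta> \<longleftrightarrow> r \<ge> 1 \<and> \<delta> \<ge> 2 \<and> (\<forall>i<n. has_locality n C r \<delta> i)"

definition optimal_LRC :: "nat \<Rightarrow> nat \<Rightarrow> (nat \<Rightarrow> 'a::zero) set \<Rightarrow> int \<Rightarrow> nat \<Rightarrow> bool" where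
  "optimal_LRC n k C r \<delta> \<longleftrightarrow> is_LRC n C r \<delta> \<and>
     int (min_dist n C) = int n - int k - (\<lceil>real k / real_of_int r\<rceil> - 1) * (int \<delta> - 1) + 1"

definition setA :: "'a::field \<Rightarrow> nat \<Rightarrow> nat \<Rightarrow> nat \<Rightarrow> (nat \<Rightarrow> nat) \<Rightarrow> nat \<Rightarrow> 'a set" where
  "setA \<alpha> t b m i s = {\<alpha> ^ (t + l * b) | l. l < m} \<union> {\<alpha> ^ (t + i l * b) | l. 1 \<le> l \<and> l \<le> s}"

definition setB :: "'a::field \<Rightarrow> nat \<Rightarrow> nat \<Rightarrow> 'a set" where
  "setB \<alpha> b \<delta> = {\<alpha> powi (j * int b) | j. - ((int \<delta> - 3) div 2) \<le> j \<and> j \<le> (int \<delta> - 1) div 2}"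

end

theory Submission
  imports Defs "HOL-Computational_Algebra.Primes" "HOL-Library.FuncSet" "HOL-Library.Set_Algebras"
begin

text \<open>With \<open>g = \<alpha> ^ b\<close>, the set \<open>B\<close> consists of \<open>\<delta> - 1\<close> consecutive powers of \<open>g\<close>. If \<open>u\<close> is a word of
  minimum weight in the dual of the code with defining set \<open>A\<close>, then for every \<open>x\<close> in \<open>C\<^sub>A\<^sub>B\<close> the
  pointwise product of \<open>u\<close> and \<open>x\<close> vanishes at \<open>B\<close>, so by the BCH bound the support of \<open>u\<close> is a
  repair set; cyclic shifts of \<open>u\<close> reach every coordinate. The exponents of \<open>AB\<close> form one run of
  length \<open>m + \<delta> - 2\<close> and \<open>s\<close> disjoint runs of length \<open>\<delta> - 1\<close>, which gives the dimension, and the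
  BCH bound on the long run gives \<open>d \<ge> m + \<delta> - 1\<close>. When \<open>\<lceil>k / r\<rceil> = s + 1\<close> this equals the
  Singleton-type upper bound for locally repairable codes, which follows by counting.\<close>

section \<open>The Frobenius map of a quadratic extension\<close>

text \<open>The library fact \<open>finite_field_power_card_eq_same\<close> needs the class \<open>finite_field\<close>, which the sort
  \<open>{finite, field}\<close> does not provide.\<close>
lemma power_card_UNIV_eq_self:
  fixes x :: "'a::{finite, field}"
  shows "x ^ card (UNIV :: 'a set) = x"
proof (cases "x = 0")
  case False
  let ?P = "\<Prod>y\<in>UNIV - {0 :: 'a}. y"
  have "?P = (\<Prod>y\<in>UNIV - {0}. x * y)"
    by (rule prod.reindex_bij_witness[of _ "\<lambda>y. x * y" "\<lambda>y. y / x"]) (use False in auto)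
  also have "\<dots> = x ^ (card (UNIV :: 'a set) - 1) * ?P"
    by (simp add: prod.distrib)
  finally have "x ^ (card (UNIV :: 'a set) - 1) = 1"
    by simp
  then have "x * x ^ (card (UNIV :: 'a set) - 1) = x"
    by simp
  then show ?thesis
    using finite_UNIV_card_ge_0[where ?'a = 'a] by (simp add: power_eq_if)
qed (use finite_UNIV_card_ge_0[where ?'a = 'a] in auto)

lemma CHAR_dvd_card_UNIV: "CHAR('a::{finite, field}) dvd card (UNIV :: 'a set)"
proof -
  have "(\<Sum>x\<in>UNIV. x :: 'a) = (\<Sum>x\<in>UNIV. x + 1)"
    by (rule sum.reindex_bij_witness[of _ "\<lambda>x. x + 1" "\<lambda>x. x - 1"]) auto
  then show ?thesis
    by (simp add: sum.distrib flip: of_nat_eq_0_iff_char_dvd)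
qed

lemma prime_CHAR_finite_field: "prime CHAR('a::{finite, field})"
  using finite_imp_CHAR_pos[where ?'a = 'a] by (simp add: prime_CHAR_semidom)

lemma card_roots_trinomial_le:
  fixes a y :: "'a::idom"
  assumes "N > 1"
  shows "card {x. x ^ N + a * x = y} \<le> N"
proof -
  define p where "p = monom 1 N + [:- y, a:]"
  have "degree p = N"
    unfolding p_def using assms by (subst degree_add_eq_left) (auto simp: degree_monom_eq)
  moreover have "p \<noteq> 0"
    using \<open>degree p = N\<close> assms by auto
  moreover have "{x. x ^ N + a * x = y} = {x. poly p x = 0}"
    by (auto simp: p_def poly_monom algebra_simps)
  ultimately show ?thesis
    using card_poly_roots_bound[of p] by simp
qed

lemma prime_power_gt_1: "prime_power q \<Longrightarrow> q > 1"
  unfolding prime_power_def by (metis One_nat_def Suc_le_eq one_less_power prime_gt_1_nat)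

locale quadratic_finite_field =
  fixes q :: nat and field_type :: "'a::{finite, field} itself"
  assumes prime_power: "prime_power q" and card_UNIV: "card (UNIV :: 'a set) = q ^ 2"
begin

lemma q_gt_1: "q > 1"
  using prime_power by (rule prime_power_gt_1)

lemma q_neq_0 [simp]: "q \<noteq> 0"
  using q_gt_1 by simp

lemma q_eq_CHAR_power: "\<exists>e. q = CHAR('a) ^ e"
proof -
  obtain p e where p: "prime p" and q: "q = p ^ e"
    using prime_power by (auto simp: prime_power_def)
  have "CHAR('a) dvd p ^ (e * 2)"
    using CHAR_dvd_card_UNIV[where ?'a = 'a] by (simp add: card_UNIV q power_mult)
  then have "CHAR('a) = p"
    using prime_CHAR_finite_field[where ?'a = 'a] p prime_dvd_power primes_dvd_imp_eq by blast
  then show ?thesis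
    using q by auto
qed

lemma frobenius_sum: "sum f S ^ q = (\<Sum>x\<in>S. f x ^ q)" for f :: "'b \<Rightarrow> 'a"
proof -
  obtain e where "q = CHAR('a) ^ e"
    using q_eq_CHAR_power ..
  with prime_CHAR_finite_field show ?thesis
    by (rule freshmans_dream_sum')
qed

lemma frobenius_add: "(x + y) ^ q = x ^ q + y ^ q" for x y :: 'a
  using frobenius_sum[of "\<lambda>b. if b then x else y" UNIV] by (simp add: UNIV_bool add.commute)

lemma frobenius_diff: "(x - y) ^ q = x ^ q - y ^ q" for x y :: 'a
  using frobenius_add[of "x - y" y] by (simp add: algebra_simps)

lemma frobenius_minus: "(- x) ^ q = - (x ^ q)" for x :: 'a
  using frobenius_diff[of 0 x] by (simp add: power_0_left)

lemma frobenius_frobenius: "(x ^ q) ^ q = x" for x :: 'a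
  using power_card_UNIV_eq_self[of x] by (simp add: card_UNIV power2_eq_square power_mult)

lemma inj_on_frobenius: "inj_on (\<lambda>x :: 'a. x ^ q) S"
  by (rule inj_on_inverseI) (rule frobenius_frobenius)

lemma zero_in_subfield_Fq: "0 \<in> (subfield_Fq q :: 'a set)"
  by (simp add: subfield_Fq_def power_0_left)

text \<open>The trace \<open>x \<mapsto> x ^ q + x\<close> takes values in the subfield and has at most \<open>q\<close> preimages of each
  value, so it takes at least \<open>q\<close> values.\<close>
lemma card_subfield_Fq: "card (subfield_Fq q :: 'a set) = q"
proof (rule antisym)
  have "subfield_Fq q = {x :: 'a. x ^ q + (- 1) * x = 0}"
    by (auto simp: subfield_Fq_def)
  then show "card (subfield_Fq q :: 'a set) \<le> q"
    using card_roots_trinomial_le[OF q_gt_1, of "- 1" "0 :: 'a"] by simp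
next
  define trace where "trace = (\<lambda>x :: 'a. x ^ q + 1 * x)"
  have "(\<Union>y\<in>range trace. {x. trace x = y}) = UNIV"
    by auto
  then have "q * q = card (\<Union>y\<in>range trace. {x. trace x = y})"
    by (simp add: card_UNIV power2_eq_square)
  also have "\<dots> \<le> (\<Sum>y\<in>range trace. card {x. trace x = y})"
    by (rule card_UN_le) simp
  also have "\<dots> \<le> (\<Sum>y\<in>range trace. q)"
    unfolding trace_def using q_gt_1 by (intro sum_mono card_roots_trinomial_le)
  finally have "q \<le> card (range trace)"
    using q_gt_1 by simp
  also have "range trace \<subseteq> subfield_Fq q"
    by (auto simp: trace_def subfield_Fq_def frobenius_add frobenius_frobenius add.commute)
  then have "card (range trace) \<le> card (subfield_Fq q :: 'a set)"
    by (intro card_mono) auto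
  finally show "q \<le> card (subfield_Fq q :: 'a set)" .
qed

definition frobenius_poly :: "'a poly \<Rightarrow> 'a poly" where
  "frobenius_poly p = map_poly (\<lambda>c. c ^ q) p"

lemma coeff_frobenius_poly: "coeff (frobenius_poly p) i = coeff p i ^ q"
  by (simp add: frobenius_poly_def coeff_map_poly power_0_left)

lemma degree_frobenius_poly: "degree (frobenius_poly p) = degree p"
  unfolding frobenius_poly_def by (rule degree_map_poly) auto

lemma frobenius_poly_eq_self_iff:
  "frobenius_poly p = p \<longleftrightarrow> (\<forall>i. coeff p i \<in> subfield_Fq q)"
  by (simp add: poly_eq_iff coeff_frobenius_poly subfield_Fq_def)

lemma frobenius_poly_add: "frobenius_poly (p + p') = frobenius_poly p + frobenius_poly p'"
  by (simp add: poly_eq_iff coeff_frobenius_poly frobenius_add)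

lemma frobenius_poly_diff: "frobenius_poly (p - p') = frobenius_poly p - frobenius_poly p'"
  by (simp add: poly_eq_iff coeff_frobenius_poly frobenius_diff)

lemma frobenius_poly_mult: "frobenius_poly (p * p') = frobenius_poly p * frobenius_poly p'"
  by (simp add: poly_eq_iff coeff_frobenius_poly coeff_mult frobenius_sum power_mult_distrib)

lemma frobenius_poly_prod: "frobenius_poly (\<Prod>x\<in>S. f x) = (\<Prod>x\<in>S. frobenius_poly (f x))"
  by (induction S rule: infinite_finite_induct)
    (simp_all add: frobenius_poly_mult, simp_all add: frobenius_poly_def)

lemma frobenius_poly_mod: "frobenius_poly (p mod d) = frobenius_poly p mod frobenius_poly d"
proof (cases "p mod d = 0")
  case True
  then have "frobenius_poly d dvd frobenius_poly p"
    by (auto simp: frobenius_poly_mult mod_eq_0_iff_dvd)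
  with True show ?thesis
    by (simp add: frobenius_poly_def)
next
  case False
  have "frobenius_poly p = frobenius_poly (p div d) * frobenius_poly d + frobenius_poly (p mod d)"
    by (simp flip: frobenius_poly_mult frobenius_poly_add)
  moreover have "d = 0 \<or> degree (frobenius_poly (p mod d)) < degree (frobenius_poly d)"
    using degree_mod_less'[of d p] False by (auto simp: degree_frobenius_poly)
  ultimately show ?thesis
    by (auto simp: mod_poly_less)
qed

lemma frobenius_poly_xn_minus_1: "frobenius_poly (xn_minus_1 n) = xn_minus_1 n"
  by (simp add: xn_minus_1_def frobenius_poly_diff)
    (simp add: poly_eq_iff coeff_frobenius_poly power_0_left)

lemma frobenius_poly_gen_poly:
  fixes Z :: "'a set"
  assumes "\<And>x. x \<in> Z \<Longrightarrow> x ^ q \<in> Z"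
  shows "frobenius_poly (gen_poly Z) = gen_poly Z"
proof -
  have "frobenius_poly (gen_poly Z) = (\<Prod>x\<in>Z. [:- (x ^ q), 1:])"
    unfolding gen_poly_def frobenius_poly_prod
    by (simp add: frobenius_poly_def map_poly_pCons frobenius_minus power_0_left)
  also have "\<dots> = gen_poly ((\<lambda>x. x ^ q) ` Z)"
    by (simp add: gen_poly_def prod.reindex inj_on_frobenius)
  also have "(\<lambda>x. x ^ q) ` Z = Z"
    using assms by (intro endo_inj_surj inj_on_frobenius) auto
  finally show ?thesis .
qed

end

section \<open>Roots of unity\<close>

lemma degree_xn_minus_1:
  assumes "n > 0"
  shows "degree (xn_minus_1 n :: 'a::field poly) = n"
  unfolding xn_minus_1_def diff_conv_add_uminus
  using assms by (subst degree_add_eq_left) (auto simp: degree_monom_eq)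

lemma xn_minus_1_neq_0: "n > 0 \<Longrightarrow> xn_minus_1 n \<noteq> (0 :: 'a::field poly)"
  by (metis degree_0 degree_xn_minus_1 less_irrefl)

lemma poly_xn_minus_1: "poly (xn_minus_1 n) x = x ^ n - 1"
  by (simp add: xn_minus_1_def poly_monom)

definition roots_of_unity :: "nat \<Rightarrow> 'a::monoid_mult set" where
  "roots_of_unity n = {x. x ^ n = 1}"

lemma roots_of_unity_eq_roots_xn_minus_1:
  "roots_of_unity n = {x. poly (xn_minus_1 n) x = (0 :: 'a::field)}"
  by (simp add: roots_of_unity_def poly_xn_minus_1)

lemma finite_roots_of_unity: "n > 0 \<Longrightarrow> finite (roots_of_unity n :: 'a::field set)"
  by (simp add: roots_of_unity_eq_roots_xn_minus_1 poly_roots_finite xn_minus_1_neq_0)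

lemma root_of_unity_neq_0: "x \<in> roots_of_unity n \<Longrightarrow> n > 0 \<Longrightarrow> x \<noteq> (0 :: 'a::field)"
  by (auto simp: roots_of_unity_def power_0_left)

lemma power_in_roots_of_unity: "x \<in> roots_of_unity n \<Longrightarrow> x ^ e \<in> roots_of_unity n"
  by (simp add: roots_of_unity_def) (metis mult.commute power_mult power_one)

lemma mult_in_roots_of_unity:
  "x \<in> roots_of_unity n \<Longrightarrow> y \<in> roots_of_unity n \<Longrightarrow> x * y \<in> roots_of_unity n"
  for x :: "'a::comm_monoid_mult"
  by (simp add: roots_of_unity_def power_mult_distrib)

lemma inverse_in_roots_of_unity: "x \<in> roots_of_unity n \<Longrightarrow> inverse x \<in> roots_of_unity n"
  for x :: "'a::field"
  by (simp add: roots_of_unity_def power_inverse)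

lemma power_mod_exponent:
  fixes x :: "'a::monoid_mult"
  assumes "x \<in> roots_of_unity n"
  shows "x ^ (e mod n) = x ^ e"
proof -
  have "x ^ e = x ^ (n * (e div n) + e mod n)"
    by simp
  also have "\<dots> = (x ^ n) ^ (e div n) * x ^ (e mod n)"
    by (simp only: power_add power_mult)
  also have "\<dots> = x ^ (e mod n)"
    using assms by (simp add: roots_of_unity_def)
  finally show ?thesis ..
qed

lemma primitive_root_in_roots_of_unity: "primitive_root_of_unity n g \<Longrightarrow> g \<in> roots_of_unity n"
  by (simp add: primitive_root_of_unity_def roots_of_unity_def)

lemma primitive_root_power_eq_1_iff_dvd:
  assumes "primitive_root_of_unity n g" and "n > 0"
  shows "g ^ e = 1 \<longleftrightarrow> n dvd e"
proof -
  have "g ^ e = 1 \<longleftrightarrow> g ^ (e mod n) = 1"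
    by (simp add: power_mod_exponent primitive_root_in_roots_of_unity[OF assms(1)])
  also have "\<dots> \<longleftrightarrow> e mod n = 0"
    using assms
    by (metis bot_nat_0.not_eq_extremum mod_less_divisor power_0 primitive_root_of_unity_def)
  finally show ?thesis
    by (simp add: dvd_eq_mod_eq_0)
qed

lemma primitive_root_power_coprime:
  assumes "primitive_root_of_unity n g" and "n > 0" and "coprime b n"
  shows "primitive_root_of_unity n (g ^ b)"
proof -
  have "(g ^ b) ^ e = 1 \<longleftrightarrow> n dvd e" for e
    using assms(3)
    by (simp add: primitive_root_power_eq_1_iff_dvd[OF assms(1,2)] coprime_commute
        coprime_dvd_mult_right_iff flip: power_mult)
  then show ?thesis
    by (auto simp: primitive_root_of_unity_def dest: dvd_imp_le)
qed

lemma inj_on_primitive_root_power: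
  assumes "primitive_root_of_unity n g" and "n > 0"
  shows "inj_on (\<lambda>e. g ^ e) {..<n}"
proof (rule linorder_inj_onI')
  fix e e'
  assume e: "e \<in> {..<n}" "e' \<in> {..<n}" "e < e'"
  have "g ^ e' = g ^ e * g ^ (e' - e)"
    using e(3) by (simp flip: power_add)
  moreover have "g ^ (e' - e) \<noteq> 1"
    using e assms by (auto simp: primitive_root_of_unity_def)
  ultimately show "g ^ e \<noteq> g ^ e'"
    using root_of_unity_neq_0[OF primitive_root_in_roots_of_unity[OF assms(1)] assms(2)] by simp
qed

lemma roots_of_unity_eq_primitive_root_powers:
  fixes g :: "'a::field"
  assumes "primitive_root_of_unity n g" and "n > 0"
  shows "roots_of_unity n = (\<lambda>e. g ^ e) ` {..<n}"
proof (rule sym, rule card_seteq)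
  show "finite (roots_of_unity n :: 'a set)"
    using assms(2) by (rule finite_roots_of_unity)
  show "(\<lambda>e. g ^ e) ` {..<n} \<subseteq> roots_of_unity n"
    by (auto intro: power_in_roots_of_unity primitive_root_in_roots_of_unity[OF assms(1)])
  have "card (roots_of_unity n :: 'a set) \<le> n"
    using card_poly_roots_bound[OF xn_minus_1_neq_0[OF assms(2)]]
    by (simp add: roots_of_unity_eq_roots_xn_minus_1 degree_xn_minus_1[OF assms(2)])
  then show "card (roots_of_unity n :: 'a set) \<le> card ((\<lambda>e. g ^ e) ` {..<n})"
    by (simp add: card_image inj_on_primitive_root_power[OF assms])
qed

lemma union_of_cyclotomic_cosets_power_closed:
  assumes "primitive_root_of_unity n g" and "n > 0"
    and "union_of_cyclotomic_cosets q n g Z" and "Z \<subseteq> roots_of_unity n" and "x \<in> Z"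
  shows "x ^ q \<in> Z"
proof -
  obtain e where "e < n" and x: "x = g ^ e"
    using roots_of_unity_eq_primitive_root_powers[OF assms(1,2)] assms(4,5) by blast
  then have "g ^ ((q * e) mod n) \<in> Z"
    using assms(3,5) by (simp add: union_of_cyclotomic_cosets_def)
  then show ?thesis
    by (simp add: x power_mod_exponent primitive_root_in_roots_of_unity[OF assms(1)] mult.commute
        power_mult)
qed

definition geometric_set :: "'a::monoid_mult \<Rightarrow> 'a \<Rightarrow> nat set \<Rightarrow> 'a set" where
  "geometric_set c g E = (\<lambda>e. c * g ^ e) ` E"

lemma geometric_set_subset_roots_of_unity:
  fixes c g :: "'a::comm_monoid_mult"
  assumes "c \<in> roots_of_unity n" and "g \<in> roots_of_unity n"
  shows "geometric_set c g E \<subseteq> roots_of_unity n"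
  using assms by (auto simp: geometric_set_def intro: mult_in_roots_of_unity power_in_roots_of_unity)

lemma card_geometric_set:
  assumes "primitive_root_of_unity n g" and "n > 0" and "c \<noteq> 0" and "E \<subseteq> {..<n}"
  shows "card (geometric_set c g E) = card E"
  unfolding geometric_set_def
proof (rule card_image)
  show "inj_on (\<lambda>e. c * g ^ e) E"
    using inj_on_subset[OF inj_on_primitive_root_power[OF assms(1,2)] assms(4)] assms(3)
    by (simp add: inj_on_def)
qed

section \<open>Words as polynomials\<close>

definition words :: "nat \<Rightarrow> (nat \<Rightarrow> 'a::zero) set" where
  "words n = {c. \<forall>i\<ge>n. c i = 0}"

lemma words_neqE:
  assumes "x \<noteq> y" and "x \<in> C" and "y \<in> C" and "C \<subseteq> words n"
  obtains l where "l < n" and "x l \<noteq> y l"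
proof -
  obtain l where l: "x l \<noteq> y l"
    using assms(1) by auto
  moreover have "l < n"
    using assms(2-4) l by (auto simp: words_def subset_iff) (metis not_le)
  ultimately show ?thesis
    using that by blast
qed

definition word_poly :: "nat \<Rightarrow> (nat \<Rightarrow> 'a::comm_monoid_add) \<Rightarrow> 'a poly" where
  "word_poly n c = (\<Sum>i<n. monom (c i) i)"

lemma coeff_word_poly: "coeff (word_poly n c) i = (if i < n then c i else 0)"
  by (simp add: word_poly_def coeff_sum)

lemma coeff_word_poly_words: "c \<in> words n \<Longrightarrow> coeff (word_poly n c) = c"
  by (auto simp: coeff_word_poly words_def fun_eq_iff)

lemma poly_word_poly: "poly (word_poly n c) x = (\<Sum>i<n. c i * x ^ i)"
  for x :: "'a::comm_semiring_1"
  by (simp add: word_poly_def poly_sum poly_monom)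

lemma word_poly_diff: "word_poly n (v - w) = word_poly n v - word_poly n w"
  for v w :: "nat \<Rightarrow> 'a::ab_group_add"
  by (simp add: poly_eq_iff coeff_word_poly)

lemma coeff_ge_eq_0_iff_degree_less: "(\<forall>i\<ge>n. coeff p i = 0) \<longleftrightarrow> p = 0 \<or> degree p < n"
  using leading_coeff_0_iff[of p] by (auto intro: coeff_eq_0 simp: not_le[symmetric])

lemma degree_word_poly: "n > 0 \<Longrightarrow> degree (word_poly n c) < n"
  using coeff_ge_eq_0_iff_degree_less[of n "word_poly n c"] by (auto simp: coeff_word_poly)

lemma poly_word_in_words: "poly_word n p \<in> words n"
  by (simp add: poly_word_def words_def)

lemma poly_word_word_poly: "c \<in> words n \<Longrightarrow> poly_word n (word_poly n c) = c"
  by (auto simp: poly_word_def coeff_word_poly words_def)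

lemma word_poly_poly_word: "degree p < n \<Longrightarrow> word_poly n (poly_word n p) = p"
  by (auto simp: poly_eq_iff coeff_word_poly poly_word_def coeff_eq_0)

definition polys_over :: "'a::zero set \<Rightarrow> nat \<Rightarrow> 'a poly set" where
  "polys_over F k = {p. (\<forall>i. coeff p i \<in> F) \<and> (\<forall>i\<ge>k. coeff p i = 0)}"

lemma card_polys_over:
  fixes F :: "'a::comm_monoid_add set"
  assumes "0 \<in> F"
  shows "card (polys_over F k) = card F ^ k"
proof -
  have "bij_betw (\<lambda>p. restrict (coeff p) {..<k}) (polys_over F k) ({..<k} \<rightarrow>\<^sub>E F)"
  proof (rule bij_betw_byWitness[where f' = "word_poly k"])
    show "\<forall>p\<in>polys_over F k. word_poly k (restrict (coeff p) {..<k}) = p"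
      unfolding polys_over_def by (auto intro!: poly_eqI simp: coeff_word_poly)
    show "\<forall>w\<in>{..<k} \<rightarrow>\<^sub>E F. restrict (coeff (word_poly k w)) {..<k} = w"
      by (intro ballI extensionalityI[of _ "{..<k}"]) (auto simp: coeff_word_poly PiE_def)
    show "(\<lambda>p. restrict (coeff p) {..<k}) ` polys_over F k \<subseteq> {..<k} \<rightarrow>\<^sub>E F"
      unfolding polys_over_def by (intro image_subsetI restrict_PiE_iff[THEN iffD2]) simp
    show "word_poly k ` ({..<k} \<rightarrow>\<^sub>E F) \<subseteq> polys_over F k"
      unfolding polys_over_def using assms by (intro image_subsetI) (simp add: coeff_word_poly PiE_iff)
  qed
  from bij_betw_same_card[OF this] show ?thesis
    by (simp add: card_PiE)
qed

section \<open>Cyclic codes and their roots\<close>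

lemma gen_poly_neq_0: "gen_poly Z \<noteq> (0 :: 'a::field poly)"
  by (cases "finite Z") (auto simp: gen_poly_def)

lemma degree_gen_poly: "degree (gen_poly Z :: 'a::field poly) = card Z"
  unfolding gen_poly_def by (subst degree_prod_eq_sum_degree) auto

lemma poly_gen_poly_eq_0_iff: "finite Z \<Longrightarrow> poly (gen_poly Z) x = 0 \<longleftrightarrow> (x :: 'a::field) \<in> Z"
  by (auto simp: gen_poly_def poly_prod)

lemma gen_poly_dvd_iff:
  fixes p :: "'a::field poly"
  assumes "finite Z"
  shows "gen_poly Z dvd p \<longleftrightarrow> (\<forall>x\<in>Z. poly p x = 0)"
proof
  show "\<forall>x\<in>Z. poly p x = 0" if "gen_poly Z dvd p"
    using that assms by (auto simp: poly_gen_poly_eq_0_iff)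
next
  show "gen_poly Z dvd p" if "\<forall>x\<in>Z. poly p x = 0"
    using assms that
  proof (induction Z arbitrary: p rule: finite_induct)
    case empty
    then show ?case
      by (simp add: gen_poly_def)
  next
    case (insert z Z)
    then obtain f where f: "p = [:- z, 1:] * f"
      by (metis dvdE insertI1 poly_eq_0_iff_dvd)
    have "\<forall>x\<in>Z. poly f x = 0"
      using insert.prems insert.hyps(2) f by auto
    then have "gen_poly Z dvd f"
      by (rule insert.IH)
    then show ?case
      using insert.hyps f by (simp add: gen_poly_def mult_dvd_mono del: mult_pCons_left)
  qed
qed

lemma poly_word_mod_xn_minus_1:
  fixes c :: "nat \<Rightarrow> 'a::field"
  assumes "n > 0" and "c \<in> words n"
  shows "poly_word n (word_poly n c mod xn_minus_1 n) = c"
  using assms by (simp add: mod_poly_less degree_xn_minus_1 degree_word_poly poly_word_word_poly)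

lemma cyclic_code_big_eq_roots:
  fixes Z :: "'a::field set"
  assumes "n > 0" and "Z \<subseteq> roots_of_unity n"
  shows "cyclic_code_big n Z = {c \<in> words n. \<forall>x\<in>Z. poly (word_poly n c) x = 0}"
proof -
  have "finite Z"
    using assms finite_roots_of_unity finite_subset by blast
  note gen_poly_dvd_iff = gen_poly_dvd_iff[OF this]
  show ?thesis
  proof (intro equalityI subsetI)
    fix c
    assume "c \<in> cyclic_code_big n Z"
    then obtain f where c: "c = poly_word n ((f * gen_poly Z) mod xn_minus_1 n)"
      by (auto simp: cyclic_code_big_def)
    have "gen_poly Z dvd xn_minus_1 n"
      using assms(2) by (auto simp: gen_poly_dvd_iff roots_of_unity_eq_roots_xn_minus_1)
    then have "gen_poly Z dvd (f * gen_poly Z) mod xn_minus_1 n"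
      by (simp add: dvd_mod)
    moreover have "degree ((f * gen_poly Z) mod xn_minus_1 n) < n"
      using degree_mod_less[OF xn_minus_1_neq_0, of n "f * gen_poly Z"] assms(1)
      by (auto simp: degree_xn_minus_1)
    ultimately show "c \<in> {c \<in> words n. \<forall>x\<in>Z. poly (word_poly n c) x = 0}"
      by (simp add: c poly_word_in_words word_poly_poly_word flip: gen_poly_dvd_iff)
  next
    fix c
    assume c: "c \<in> {c \<in> words n. \<forall>x\<in>Z. poly (word_poly n c) x = 0}"
    then obtain f where f: "word_poly n c = f * gen_poly Z"
      by (auto simp flip: gen_poly_dvd_iff) (metis dvdE mult.commute)
    have "c = poly_word n ((f * gen_poly Z) mod xn_minus_1 n)"
      using c assms(1) by (simp add: poly_word_mod_xn_minus_1 flip: f)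
    then show "c \<in> cyclic_code_big n Z"
      by (auto simp: cyclic_code_big_def)
  qed
qed

section \<open>Hamming weight and the BCH bound\<close>

definition support :: "nat \<Rightarrow> (nat \<Rightarrow> 'a::zero) \<Rightarrow> nat set" where
  "support n c = {i. i < n \<and> c i \<noteq> 0}"

definition hamming_weight :: "nat \<Rightarrow> (nat \<Rightarrow> 'a::zero) \<Rightarrow> nat" where
  "hamming_weight n c = card (support n c)"

lemma hamming_dist_eq_weight_diff: "hamming_dist n x y = hamming_weight n (x - y)"
  for x y :: "nat \<Rightarrow> 'a::group_add"
  by (simp add: hamming_dist_def hamming_weight_def support_def)

lemma finite_distances: "finite {hamming_dist n x y | x y. x \<in> C \<and> y \<in> C \<and> x \<noteq> y}"
proof (rule finite_subset)
  have "hamming_dist n x y \<le> n" for x y :: "nat \<Rightarrow> 'a"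
    using card_mono[of "{..<n}" "{i. i < n \<and> x i \<noteq> y i}"] by (auto simp: hamming_dist_def)
  then show "{hamming_dist n x y | x y. x \<in> C \<and> y \<in> C \<and> x \<noteq> y} \<subseteq> {..n}"
    by auto
qed simp

lemma min_dist_le_hamming_dist:
  assumes "x \<in> C" and "y \<in> C" and "x \<noteq> y"
  shows "min_dist n C \<le> hamming_dist n x y"
  unfolding min_dist_def using assms by (intro Min_le finite_distances) auto

lemma min_weight_word:
  fixes C :: "(nat \<Rightarrow> 'a::group_add) set"
  assumes "C \<subseteq> words n" and diff: "\<And>x y. x \<in> C \<Longrightarrow> y \<in> C \<Longrightarrow> x - y \<in> C"
    and "x \<in> C" and "y \<in> C" and "x \<noteq> y"
  obtains u l where "u \<in> C" and "l \<in> support n u" and "hamming_weight n u = min_dist n C"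
proof -
  have "min_dist n C \<in> {hamming_dist n x y | x y. x \<in> C \<and> y \<in> C \<and> x \<noteq> y}"
    unfolding min_dist_def using assms(3-5) by (intro Min_in finite_distances) auto
  then obtain v w where vw: "v \<in> C" "w \<in> C" "v \<noteq> w" "hamming_dist n v w = min_dist n C"
    by auto
  obtain l where "l < n" and "v l \<noteq> w l"
    using words_neqE[OF vw(3,1,2) assms(1)] .
  show ?thesis
  proof
    show "v - w \<in> C"
      using vw(1,2) by (rule diff)
    show "l \<in> support n (v - w)"
      using \<open>l < n\<close> \<open>v l \<noteq> w l\<close> by (simp add: support_def)
    show "hamming_weight n (v - w) = min_dist n C"
      using vw(4) by (simp add: hamming_dist_eq_weight_diff)
  qed
qed

text \<open>Summing \<open>w i * P (x i)\<close> for the polynomial \<open>P\<close> that vanishes at every \<open>x i\<close> except \<open>x l\<close> isolates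
  \<open>w l\<close>; this replaces inverting a Vandermonde matrix.\<close>
lemma power_sums_eq_0_imp_eq_0:
  fixes x w :: "'b \<Rightarrow> 'a::field"
  assumes "finite T" and "inj_on x T" and "card T \<le> N"
    and sums: "\<And>j. j < N \<Longrightarrow> (\<Sum>i\<in>T. w i * x i ^ j) = 0"
    and "l \<in> T"
  shows "w l = 0"
proof -
  define P where "P = gen_poly (x ` (T - {l}))"
  have roots: "poly P (x i) = 0 \<longleftrightarrow> i \<noteq> l" if "i \<in> T" for i
    using assms(1) that by (simp add: P_def poly_gen_poly_eq_0_iff inj_on_image_mem_iff[OF assms(2)])
  have "degree P = card (T - {l})"
    using assms(2) by (simp add: P_def degree_gen_poly card_image inj_on_diff)
  also have "\<dots> < N"
    using assms(1,3,5) by (metis card_Diff1_less dual_order.strict_trans1)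
  finally have degree: "degree P < N" .
  have "w l * poly P (x l) = (\<Sum>i\<in>{l}. w i * poly P (x i))"
    by simp
  also have "\<dots> = (\<Sum>i\<in>T. w i * poly P (x i))"
    using assms(1,5) roots by (intro sum.mono_neutral_left) auto
  also have "\<dots> = (\<Sum>i\<in>T. \<Sum>j\<le>degree P. coeff P j * (w i * x i ^ j))"
    by (simp add: poly_altdef sum_distrib_left mult_ac)
  also have "\<dots> = (\<Sum>j\<le>degree P. coeff P j * (\<Sum>i\<in>T. w i * x i ^ j))"
    by (subst sum.swap) (simp add: sum_distrib_left)
  also have "\<dots> = 0"
    using degree by (intro sum.neutral) (auto simp: sums)
  finally show ?thesis
    using roots[OF assms(5)] by simp
qed

lemma BCH_bound:
  fixes z :: "nat \<Rightarrow> 'a::field"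
  assumes g: "primitive_root_of_unity n g" and "c \<noteq> 0"
    and roots: "\<And>x. x \<in> geometric_set c g {..<N} \<Longrightarrow> poly (word_poly n z) x = 0"
    and "l \<in> support n z"
  shows "N < hamming_weight n z"
proof (rule ccontr)
  assume "\<not> N < hamming_weight n z"
  then have "card (support n z) \<le> N"
    by (simp add: hamming_weight_def)
  have "n > 0" and "finite (support n z)"
    using assms(4) by (auto simp: support_def)
  have inj: "inj_on (\<lambda>i. g ^ i) (support n z)"
    by (rule inj_on_subset[OF inj_on_primitive_root_power[OF g \<open>n > 0\<close>]]) (auto simp: support_def)
  have "(\<Sum>i\<in>support n z. (z i * c ^ i) * (g ^ i) ^ j) = 0" if "j < N" for j
  proof -
    have "(\<Sum>i\<in>support n z. (z i * c ^ i) * (g ^ i) ^ j) = (\<Sum>i\<in>support n z. z i * (c * g ^ j) ^ i)"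
      by (simp add: power_mult_distrib mult.assoc mult.commute[of j] flip: power_mult)
    also have "\<dots> = (\<Sum>i<n. z i * (c * g ^ j) ^ i)"
      by (intro sum.mono_neutral_left) (auto simp: support_def)
    finally show ?thesis
      using roots[of "c * g ^ j"] that by (auto simp: poly_word_poly geometric_set_def)
  qed
  with \<open>finite (support n z)\<close> inj \<open>card (support n z) \<le> N\<close> have "z l * c ^ l = 0"
    by (rule power_sums_eq_0_imp_eq_0[OF _ _ _ _ assms(4)])
  then show False
    using assms(2,4) by (simp add: support_def)
qed

section \<open>Cyclic codes over the subfield\<close>

locale Fq_cyclic_code = quadratic_finite_field q field_type
  for q :: nat and field_type :: "'a::{finite, field} itself" +
  fixes n :: nat and Z :: "'a set"
  assumes length_pos: "n > 0" and roots_of_unity: "Z \<subseteq> roots_of_unity n"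
    and frobenius_closed: "\<And>x. x \<in> Z \<Longrightarrow> x ^ q \<in> Z"
begin

lemma frobenius_poly_mult_gen_poly_eq_self_iff:
  "frobenius_poly (f * gen_poly Z) = f * gen_poly Z \<longleftrightarrow> frobenius_poly f = f"
  by (simp add: frobenius_poly_mult frobenius_poly_gen_poly[OF frobenius_closed] gen_poly_neq_0)

lemma coeff_mult_gen_poly_in_Fq_iff:
  "(\<forall>i. coeff (f * gen_poly Z) i \<in> subfield_Fq q) \<longleftrightarrow> (\<forall>i. coeff f i \<in> subfield_Fq q)"
  using frobenius_poly_mult_gen_poly_eq_self_iff by (simp only: frobenius_poly_eq_self_iff)

lemma cyclic_code_Fq_eq_subfield_subcode:
  "cyclic_code_Fq q n Z = {c \<in> cyclic_code_big n Z. range c \<subseteq> subfield_Fq q}"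
proof (intro equalityI subsetI)
  fix c
  assume "c \<in> cyclic_code_Fq q n Z"
  then obtain f where c: "c = poly_word n ((f * gen_poly Z) mod xn_minus_1 n)"
    and "frobenius_poly f = f"
    by (auto simp: cyclic_code_Fq_def frobenius_poly_eq_self_iff)
  then have "frobenius_poly (f * gen_poly Z) = f * gen_poly Z"
    by (simp add: frobenius_poly_mult_gen_poly_eq_self_iff)
  then have "frobenius_poly ((f * gen_poly Z) mod xn_minus_1 n) = (f * gen_poly Z) mod xn_minus_1 n"
    by (simp add: frobenius_poly_mod frobenius_poly_xn_minus_1)
  then have "range c \<subseteq> subfield_Fq q"
    by (auto simp: c poly_word_def frobenius_poly_eq_self_iff zero_in_subfield_Fq)
  then show "c \<in> {c \<in> cyclic_code_big n Z. range c \<subseteq> subfield_Fq q}"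
    by (auto simp: c cyclic_code_big_def)
next
  fix c
  assume c: "c \<in> {c \<in> cyclic_code_big n Z. range c \<subseteq> subfield_Fq q}"
  then have "c \<in> words n" and "gen_poly Z dvd word_poly n c"
    by (auto simp: cyclic_code_big_eq_roots length_pos roots_of_unity gen_poly_dvd_iff)
  then obtain f where f: "word_poly n c = f * gen_poly Z"
    by (metis dvdE mult.commute)
  have "frobenius_poly (word_poly n c) = word_poly n c"
    using c by (auto simp: frobenius_poly_eq_self_iff coeff_word_poly zero_in_subfield_Fq)
  then have "frobenius_poly f = f"
    by (simp add: f frobenius_poly_mult_gen_poly_eq_self_iff)
  moreover have "c = poly_word n ((f * gen_poly Z) mod xn_minus_1 n)"
    using \<open>c \<in> words n\<close> length_pos by (simp add: poly_word_mod_xn_minus_1 flip: f)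
  ultimately show "c \<in> cyclic_code_Fq q n Z"
    by (auto simp: cyclic_code_Fq_def frobenius_poly_eq_self_iff)
qed

lemma mem_cyclic_code_Fq_iff:
  "c \<in> cyclic_code_Fq q n Z \<longleftrightarrow>
    c \<in> words n \<and> range c \<subseteq> subfield_Fq q \<and> (\<forall>x\<in>Z. poly (word_poly n c) x = 0)"
  by (auto simp: cyclic_code_Fq_eq_subfield_subcode cyclic_code_big_eq_roots length_pos
      roots_of_unity)

lemma coeff_mult_gen_poly_ge_eq_0_iff:
  assumes "card Z \<le> n"
  shows "(\<forall>i\<ge>n. coeff (f * gen_poly Z) i = 0) \<longleftrightarrow> (\<forall>i\<ge>n - card Z. coeff f i = 0)"
proof (cases "f = 0")
  case False
  then have "degree (f * gen_poly Z) = degree f + card Z"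
    by (simp add: degree_mult_eq gen_poly_neq_0 degree_gen_poly)
  then show ?thesis
    using False assms by (auto simp: coeff_ge_eq_0_iff_degree_less gen_poly_neq_0)
qed simp

lemma cyclic_code_Fq_eq_image_mult_gen_poly:
  assumes "card Z \<le> n"
  shows "cyclic_code_Fq q n Z =
    (\<lambda>f. coeff (f * gen_poly Z)) ` polys_over (subfield_Fq q) (n - card Z)"
proof (intro equalityI subsetI)
  fix c
  assume "c \<in> cyclic_code_Fq q n Z"
  then have c: "c \<in> words n" "range c \<subseteq> subfield_Fq q" and "gen_poly Z dvd word_poly n c"
    by (auto simp: mem_cyclic_code_Fq_iff gen_poly_dvd_iff)
  then obtain f where "word_poly n c = f * gen_poly Z"
    by (metis dvdE mult.commute)
  then have f: "coeff (f * gen_poly Z) = c"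
    using coeff_word_poly_words[OF c(1)] by simp
  then have "\<forall>i\<ge>n - card Z. coeff f i = 0"
    using c(1) assms by (simp add: words_def flip: coeff_mult_gen_poly_ge_eq_0_iff)
  moreover have "\<forall>i. coeff f i \<in> subfield_Fq q"
    using c(2) f coeff_mult_gen_poly_in_Fq_iff[of f] by (simp add: image_subset_iff)
  ultimately show "c \<in> (\<lambda>f. coeff (f * gen_poly Z)) ` polys_over (subfield_Fq q) (n - card Z)"
    unfolding polys_over_def using f by blast
next
  fix c
  assume "c \<in> (\<lambda>f. coeff (f * gen_poly Z)) ` polys_over (subfield_Fq q) (n - card Z)"
  then obtain f where c: "c = coeff (f * gen_poly Z)" and "\<forall>i. coeff f i \<in> subfield_Fq q"
    and low: "\<forall>i\<ge>n - card Z. coeff f i = 0"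
    unfolding polys_over_def by blast
  then have "range c \<subseteq> subfield_Fq q"
    using coeff_mult_gen_poly_in_Fq_iff[of f] by (simp add: image_subset_iff)
  moreover have "c \<in> words n"
    using low assms by (simp add: c words_def coeff_mult_gen_poly_ge_eq_0_iff)
  moreover have "word_poly n c = f * gen_poly Z"
    using coeff_word_poly_words[OF \<open>c \<in> words n\<close>] by (simp add: c coeff_inject)
  then have "gen_poly Z dvd word_poly n c"
    by simp
  ultimately show "c \<in> cyclic_code_Fq q n Z"
    by (simp add: mem_cyclic_code_Fq_iff gen_poly_dvd_iff)
qed

lemma card_cyclic_code_Fq:
  assumes "card Z \<le> n"
  shows "card (cyclic_code_Fq q n Z) = q ^ (n - card Z)"
proof -
  have "inj_on (\<lambda>f. coeff (f * gen_poly Z)) S" for S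
    by (intro inj_onI) (simp add: coeff_inject gen_poly_neq_0)
  then show ?thesis
    by (simp add: cyclic_code_Fq_eq_image_mult_gen_poly[OF assms] card_image
        card_polys_over zero_in_subfield_Fq card_subfield_Fq)
qed

lemma BCH_min_dist:
  assumes "primitive_root_of_unity n g" and "c \<noteq> 0" and "geometric_set c g {..<N} \<subseteq> Z"
    and "x \<in> cyclic_code_Fq q n Z" and "y \<in> cyclic_code_Fq q n Z" and "x \<noteq> y"
  shows "N < min_dist n (cyclic_code_Fq q n Z)"
proof -
  have "v - w \<in> cyclic_code_Fq q n Z"
    if "v \<in> cyclic_code_Fq q n Z" "w \<in> cyclic_code_Fq q n Z" for v w
    using that
    by (auto simp: mem_cyclic_code_Fq_iff words_def word_poly_diff image_subset_iff
        subfield_Fq_def frobenius_diff)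
  moreover have "cyclic_code_Fq q n Z \<subseteq> words n"
    by (auto simp: mem_cyclic_code_Fq_iff)
  ultimately obtain u l where u: "u \<in> cyclic_code_Fq q n Z" "l \<in> support n u"
    "hamming_weight n u = min_dist n (cyclic_code_Fq q n Z)"
    using min_weight_word[OF _ _ assms(4-6)] by blast
  with assms(1-3) have "N < hamming_weight n u"
    by (intro BCH_bound) (auto simp: mem_cyclic_code_Fq_iff)
  then show ?thesis
    by (simp add: u(3))
qed

end

section \<open>The Singleton-type bound for locally repairable codes\<close>

definition repair_set :: "nat \<Rightarrow> (nat \<Rightarrow> 'a) set \<Rightarrow> nat \<Rightarrow> nat set \<Rightarrow> bool" where
  "repair_set n C \<delta> S \<longleftrightarrow> S \<subseteq> {..<n} \<and>
    (\<forall>x\<in>C. \<forall>y\<in>C. (\<exists>j\<in>S. x j \<noteq> y j) \<longrightarrow> \<delta> \<le> card {j \<in> S. x j \<noteq> y j})"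

lemma has_locality_iff_repair_set:
  fixes C :: "(nat \<Rightarrow> 'a::zero) set"
  shows "has_locality n C r \<delta> l \<longleftrightarrow>
    (\<exists>S. repair_set n C \<delta> S \<and> l \<in> S \<and> int (card S) \<le> r + int \<delta> - 1)"
proof -
  have neq_iff: "puncture x S \<noteq> puncture y S \<longleftrightarrow> (\<exists>j\<in>S. x j \<noteq> y j)" for x y :: "nat \<Rightarrow> 'a" and S
    by (auto simp: puncture_def fun_eq_iff)
  have dist: "hamming_dist n (puncture x S) (puncture y S) = card {j \<in> S. x j \<noteq> y j}"
    if "S \<subseteq> {..<n}" for x y :: "nat \<Rightarrow> 'a" and S
    unfolding hamming_dist_def puncture_def using that by (intro arg_cong[where f = card]) auto
  have "repair_set n C \<delta> S \<longleftrightarrow> S \<subseteq> {..<n} \<and> (\<forall>x\<in>C. \<forall>y\<in>C. puncture x S \<noteq> puncture y S \<longrightarrow>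
      \<delta> \<le> hamming_dist n (puncture x S) (puncture y S))" for S
    unfolding repair_set_def neq_iff by (rule conj_cong[OF refl]) (simp only: dist)
  then show ?thesis
    by (simp only: has_locality_def conj_ac)
qed

lemma repair_set_card_ge:
  assumes "repair_set n C \<delta> S" and "x \<in> C" and "y \<in> C" and "j \<in> S" and "x j \<noteq> y j"
  shows "\<delta> \<le> card S"
proof -
  have "\<delta> \<le> card {j \<in> S. x j \<noteq> y j}"
    using assms by (auto simp: repair_set_def)
  also have "\<dots> \<le> card S"
    using assms(1) by (intro card_mono) (auto simp: repair_set_def intro: finite_subset)
  finally show ?thesis .
qed

lemma repair_set_recovers:
  assumes "repair_set n C \<delta> S" and "finite V" and "card V < \<delta>"
    and "x \<in> C" and "y \<in> C" and agree: "\<forall>j\<in>S - V. x j = y j" and "j \<in> S"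
  shows "x j = y j"
proof (rule ccontr)
  assume "x j \<noteq> y j"
  then have "\<delta> \<le> card {j \<in> S. x j \<noteq> y j}"
    using assms(1,4,5,7) by (auto simp: repair_set_def)
  also have "\<dots> \<le> card V"
    using assms(2) agree by (intro card_mono) auto
  finally show False
    using assms(3) by simp
qed

definition determines :: "(nat \<Rightarrow> 'a) set \<Rightarrow> nat set \<Rightarrow> nat set \<Rightarrow> bool" where
  "determines C U T \<longleftrightarrow> (\<forall>x\<in>C. \<forall>y\<in>C. (\<forall>j\<in>U. x j = y j) \<longrightarrow> (\<forall>j\<in>T. x j = y j))"

lemma determinesD:
  "determines C U T \<Longrightarrow> x \<in> C \<Longrightarrow> y \<in> C \<Longrightarrow> \<forall>j\<in>U. x j = y j \<Longrightarrow> j \<in> T \<Longrightarrow> x j = y j"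
  unfolding determines_def by blast

lemma card_repair_set_diff_determined_ge:
  assumes "determines C U T" and S: "repair_set n C \<delta> S"
    and "x \<in> C" and "y \<in> C" and "\<forall>j\<in>U. x j = y j" and "l \<in> S" and "x l \<noteq> y l"
  shows "\<delta> \<le> card (S - T)"
proof (rule ccontr)
  assume "\<not> \<delta> \<le> card (S - T)"
  moreover have "finite (S - T)"
    using S by (auto simp: repair_set_def intro: finite_subset)
  moreover have "\<forall>j\<in>S - (S - T). x j = y j"
    using determinesD[OF assms(1,3-5)] by auto
  ultimately have "x l = y l"
    using repair_set_recovers[OF S _ _ assms(3,4) _ assms(6), of "S - T"] by auto
  then show False
    using assms(7) by simp
qed

lemma determines_Un_repair_set:
  assumes UT: "determines C U T" and S: "repair_set n C \<delta> S" and "finite W" and "card W < \<delta>"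
  shows "determines C (U \<union> (S - T - W)) (T \<union> S)"
  unfolding determines_def
proof (intro ballI impI)
  fix x y j
  assume xy: "x \<in> C" "y \<in> C" and agree: "\<forall>j\<in>U \<union> (S - T - W). x j = y j" and j: "j \<in> T \<union> S"
  have on_T: "x j = y j" if "j \<in> T" for j
    using determinesD[OF UT xy _ that] agree by simp
  then have "\<forall>j\<in>S - W. x j = y j"
    using agree by auto
  then have "x j = y j" if "j \<in> S"
    using repair_set_recovers[OF S assms(3,4) xy _ that] by simp
  then show "x j = y j"
    using on_T j by blast
qed

text \<open>Of the at least \<open>\<delta>\<close> undetermined coordinates of a repair set \<open>S\<close>, all but \<open>\<delta> - 1\<close> are adjoined
  to \<open>U\<close>.\<close>
lemma LRC_enlarge_determining_set:
  assumes lrc: "is_LRC n C r \<delta>" and "C \<subseteq> words n"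
    and "U \<subseteq> {..<n}" and "T \<subseteq> {..<n}" and UT: "determines C U T"
    and xy: "x \<in> C" "y \<in> C" "\<forall>j\<in>U. x j = y j" and "x \<noteq> y"
  obtains U' T' where "U' \<subseteq> {..<n}" and "T' \<subseteq> {..<n}" and "determines C U' T'"
    and "card U' + card T + (\<delta> - 1) \<le> card U + card T'" and "int (card U') \<le> int (card U) + r"
proof -
  obtain l where l: "l < n" "x l \<noteq> y l"
    using words_neqE[OF assms(9) xy(1,2) assms(2)] .
  then obtain S where S: "repair_set n C \<delta> S" "l \<in> S" "int (card S) \<le> r + int \<delta> - 1"
    using lrc by (auto simp: is_LRC_def has_locality_iff_repair_set)
  have large: "\<delta> \<le> card (S - T)"
    using UT S(1) xy S(2) l(2) by (rule card_repair_set_diff_determined_ge)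
  then have "\<delta> - 1 \<le> card (S - T)"
    by simp
  then obtain W where W: "W \<subseteq> S - T" "card W = \<delta> - 1"
    by (meson obtain_subset_with_card_n)
  have "S \<subseteq> {..<n}" and "\<delta> \<ge> 2"
    using S(1) lrc by (auto simp: repair_set_def is_LRC_def)
  then have fin: "finite S" "finite T" "finite W"
    using W(1) assms(4) by (auto intro: finite_subset)
  define V where "V = S - T - W"
  have card_V: "card V + (\<delta> - 1) = card (S - T)"
    unfolding V_def using W fin(3) large by (simp add: card_Diff_subset)
  show ?thesis
  proof
    show "U \<union> V \<subseteq> {..<n}" and "T \<union> S \<subseteq> {..<n}"
      unfolding V_def using assms(3,4) \<open>S \<subseteq> {..<n}\<close> by auto
    show "determines C (U \<union> V) (T \<union> S)"
      unfolding V_def using UT S(1) fin(3)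
      by (rule determines_Un_repair_set) (use W(2) \<open>\<delta> \<ge> 2\<close> in simp)
    have "card (T \<union> S) = card T + card (S - T)"
      using fin card_Un_disjoint[of T "S - T"] by simp
    then show "card (U \<union> V) + card T + (\<delta> - 1) \<le> card U + card (T \<union> S)"
      using card_Un_le[of U V] card_V by linarith
    have "card (S - T) \<le> card S"
      using fin(1) by (simp add: card_mono)
    then show "int (card (U \<union> V)) \<le> int (card U) + r"
      using card_Un_le[of U V] card_V S(3) \<open>\<delta> \<ge> 2\<close> by linarith
  qed
qed

definition undetermined_below :: "(nat \<Rightarrow> 'a) set \<Rightarrow> nat \<Rightarrow> bool" where
  "undetermined_below C k \<longleftrightarrow>
    (\<forall>U. finite U \<longrightarrow> card U < k \<longrightarrow> (\<exists>x\<in>C. \<exists>y\<in>C. x \<noteq> y \<and> (\<forall>j\<in>U. x j = y j)))"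

lemma undetermined_below_if_card_eq_power:
  assumes "finite F" and "card F > 1" and "\<And>c. c \<in> C \<Longrightarrow> range c \<subseteq> F" and "card C = card F ^ k"
  shows "undetermined_below C k"
  unfolding undetermined_below_def
proof (intro allI impI)
  fix U :: "nat set"
  assume U: "finite U" "card U < k"
  have "card (U \<rightarrow>\<^sub>E F) < card C"
    using U assms(2,4) by (simp add: card_PiE power_strict_increasing)
  moreover have "(\<lambda>x. restrict x U) ` C \<subseteq> U \<rightarrow>\<^sub>E F"
    using assms(3) by (auto simp: image_subset_iff)
  ultimately have "\<not> inj_on (\<lambda>x. restrict x U) C"
    using card_inj_on_le[of "\<lambda>x. restrict x U" C "U \<rightarrow>\<^sub>E F"] assms(1) U(1) by (auto simp: finite_PiE)
  then show "\<exists>x\<in>C. \<exists>y\<in>C. x \<noteq> y \<and> (\<forall>j\<in>U. x j = y j)"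
    by (auto simp: inj_on_def) (metis restrict_apply')
qed

lemma LRC_determining_sets:
  assumes lrc: "is_LRC n C r \<delta>" and "C \<subseteq> words n" and "undetermined_below C k"
    and "int s * r < int k"
  shows "\<exists>U T. U \<subseteq> {..<n} \<and> T \<subseteq> {..<n} \<and> determines C U T \<and>
    card U + s * (\<delta> - 1) \<le> card T \<and> int (card U) \<le> int s * r"
  using assms(4)
proof (induction s)
  case 0
  show ?case
    by (intro exI[of _ "{}"]) (simp add: determines_def)
next
  case (Suc s)
  have "r \<ge> 1"
    using lrc by (simp add: is_LRC_def)
  then have "int s * r < int k"
    using Suc.prems by (simp add: algebra_simps)
  then obtain U T where UT: "U \<subseteq> {..<n}" "T \<subseteq> {..<n}" "determines C U T"
    "card U + s * (\<delta> - 1) \<le> card T" "int (card U) \<le> int s * r"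
    using Suc.IH by blast
  have "finite U"
    using UT(1) by (rule finite_subset) simp
  moreover have "card U < k"
    using UT(5) \<open>int s * r < int k\<close> by linarith
  ultimately obtain x y where xy: "x \<in> C" "y \<in> C" "x \<noteq> y" "\<forall>j\<in>U. x j = y j"
    using assms(3) unfolding undetermined_below_def by blast
  obtain U' T' where "U' \<subseteq> {..<n}" "T' \<subseteq> {..<n}" "determines C U' T'"
    and cards: "card U' + card T + (\<delta> - 1) \<le> card U + card T'" "int (card U') \<le> int (card U) + r"
    using LRC_enlarge_determining_set[OF lrc assms(2) UT(1-3) xy(1,2,4,3)] .
  moreover have "card U' + Suc s * (\<delta> - 1) \<le> card T'"
    using cards(1) UT(4) by simp
  moreover have "int (card U') \<le> int (Suc s) * r"
    using cards(2) UT(5) by (simp add: distrib_right)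
  ultimately show ?case
    by blast
qed

lemma min_dist_le_if_determines:
  assumes "C \<subseteq> words n" and undetermined: "undetermined_below C k"
    and "U \<subseteq> {..<n}" and "T \<subseteq> {..<n}" and "determines C U T" and "card U < k"
  shows "min_dist n C + card T + (k - 1) \<le> n + card U"
proof -
  have fin: "finite U" "finite T"
    using assms(3,4) by (auto intro: finite_subset)
  have "card ({..<n} - T) = n - card T"
    using assms(4) fin(2) by (simp add: card_Diff_subset)
  then obtain W where W: "W \<subseteq> {..<n} - T" "card W = min (k - 1 - card U) (n - card T)"
    \<comment> \<open>In fact \<open>card W = k - 1 - card U\<close>, since two distinct words will agree on \<open>T \<union> W\<close>.\<close>
    by (metis min.cobounded2 obtain_subset_with_card_n)
  have "finite W"
    by (rule finite_subset[OF W(1)]) simp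
  have "card (U \<union> W) < k"
    using card_Un_le[of U W] W(2) assms(6) by linarith
  then obtain x y where xy: "x \<in> C" "y \<in> C" "x \<noteq> y" and UW: "\<forall>j\<in>U \<union> W. x j = y j"
    using undetermined finite_UnI[OF fin(1) \<open>finite W\<close>] unfolding undetermined_below_def by blast
  have "x j = y j" if "j \<in> T \<union> W" for j
    using determinesD[OF assms(5) xy(1,2)] UW that by blast
  then have "hamming_dist n x y \<le> card ({..<n} - (T \<union> W))"
    unfolding hamming_dist_def by (intro card_mono) auto
  also have "{..<n} - (T \<union> W) = ({..<n} - T) - W"
    by auto
  also have "card \<dots> = n - card T - card W"
    using W(1) \<open>finite W\<close> \<open>card ({..<n} - T) = n - card T\<close> by (simp add: card_Diff_subset)
  finally have dist: "hamming_dist n x y \<le> n - card T - card W" .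
  obtain l where "l < n" "x l \<noteq> y l"
    using words_neqE[OF xy(3,1,2) assms(1)] .
  then have pos: "hamming_dist n x y > 0"
    by (auto simp: hamming_dist_def card_gt_0_iff)
  then have "card W = k - 1 - card U"
    using dist W(2) by linarith
  with dist pos show ?thesis
    using min_dist_le_hamming_dist[OF xy, of n] assms(6) by linarith
qed

lemma LRC_singleton_bound:
  fixes C :: "(nat \<Rightarrow> 'a::zero) set"
  assumes lrc: "is_LRC n C r \<delta>" and "C \<subseteq> words n"
    and undetermined: "undetermined_below C k" and "k > 0"
  shows "int (min_dist n C) \<le> int n - int k - (\<lceil>real k / real_of_int r\<rceil> - 1) * (int \<delta> - 1) + 1"
proof -
  have "r \<ge> 1" and "\<delta> \<ge> 2"
    using lrc by (auto simp: is_LRC_def)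
  define s where "s = nat (\<lceil>real k / real_of_int r\<rceil> - 1)"
  have s: "\<lceil>real k / real_of_int r\<rceil> = int s + 1"
    using \<open>r \<ge> 1\<close> assms(4) by (simp add: s_def)
  then have "real s < real k / real_of_int r"
    by linarith
  then have "real_of_int (int s * r) < real_of_int (int k)"
    using \<open>r \<ge> 1\<close> by (simp add: field_simps)
  then have s_times_r_less: "int s * r < int k"
    by (simp only: of_int_less_iff)
  obtain U T where UT: "U \<subseteq> {..<n}" "T \<subseteq> {..<n}" "determines C U T"
    "card U + s * (\<delta> - 1) \<le> card T" "int (card U) \<le> int s * r"
    using LRC_determining_sets[OF lrc assms(2) undetermined s_times_r_less] by blast
  have "card U < k"
    using UT(5) s_times_r_less by linarith
  then have "min_dist n C + card T + (k - 1) \<le> n + card U"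
    by (rule min_dist_le_if_determines[OF assms(2) undetermined UT(1-3)])
  then have "int (min_dist n C) \<le> int n - (int k - 1 + int (s * (\<delta> - 1)))"
    using UT(4) by linarith
  also have "int (s * (\<delta> - 1)) = (\<lceil>real k / real_of_int r\<rceil> - 1) * (int \<delta> - 1)"
    unfolding s using \<open>\<delta> \<ge> 2\<close> by simp
  finally show ?thesis
    by simp
qed

section \<open>Locality from the dual code\<close>

definition cyclic_shift :: "nat \<Rightarrow> nat \<Rightarrow> (nat \<Rightarrow> 'a::zero) \<Rightarrow> nat \<Rightarrow> 'a" where
  "cyclic_shift n h v = (\<lambda>i. if i < n then v ((i + h) mod n) else 0)"

lemma cyclic_shift_in_words: "cyclic_shift n h v \<in> words n"
  by (simp add: cyclic_shift_def words_def)

lemma cyclic_shift_cyclic_shift: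
  "cyclic_shift n h (cyclic_shift n h' v) = cyclic_shift n (h + h') v"
  by (auto simp: cyclic_shift_def fun_eq_iff mod_simps add.assoc)

lemma cyclic_shift_multiple: "v \<in> words n \<Longrightarrow> cyclic_shift n (n * h) v = v"
  by (auto simp: cyclic_shift_def words_def fun_eq_iff)

lemma sum_rotate: "(\<Sum>i<n. f ((i + h) mod n)) = (\<Sum>i<n. f i)" for n h :: nat
proof (cases "n = 0")
  case False
  define h' where "h' = (n - 1) * h"
  have "h + h' = n * h"
    using False mult_eq_if[of n h] by (simp add: h'_def)
  then have "((i + h) mod n + h') mod n = i" and "((i + h') mod n + h) mod n = i" if "i < n" for i
    using that by (simp_all add: mod_simps add.assoc add.commute[of h' h])
  then show ?thesis
    using False
    by (intro sum.reindex_bij_witness[of _ "\<lambda>i. (i + h') mod n" "\<lambda>i. (i + h) mod n"]) auto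
qed simp

lemma sum_cyclic_shift_mult:
  "(\<Sum>i<n. cyclic_shift n h v i * cyclic_shift n h w i) = (\<Sum>i<n. v i * w i)"
  using sum_rotate[of "\<lambda>i. v i * w i" h n] by (simp add: cyclic_shift_def)

lemma hamming_weight_cyclic_shift: "hamming_weight n (cyclic_shift n h v) = hamming_weight n v"
proof -
  have weight: "hamming_weight n w = (\<Sum>i<n. of_bool (w i \<noteq> 0))" for w :: "nat \<Rightarrow> 'a"
    by (simp add: hamming_weight_def support_def lessThan_def Collect_conj_eq)
  have "hamming_weight n (cyclic_shift n h v) = (\<Sum>i<n. of_bool (v ((i + h) mod n) \<noteq> 0))"
    unfolding weight by (intro sum.cong) (auto simp: cyclic_shift_def)
  also have "\<dots> = hamming_weight n v"
    unfolding weight by (rule sum_rotate)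
  finally show ?thesis .
qed

lemma poly_word_poly_cyclic_shift:
  fixes x :: "'a::comm_ring_1"
  assumes "x \<in> roots_of_unity n"
  shows "x ^ h * poly (word_poly n (cyclic_shift n h c)) x = poly (word_poly n c) x"
proof -
  have "x ^ h * poly (word_poly n (cyclic_shift n h c)) x
      = (\<Sum>i<n. c ((i + h) mod n) * x ^ ((i + h) mod n))"
    by (simp add: poly_word_poly sum_distrib_left cyclic_shift_def power_mod_exponent[OF assms]
        power_add mult_ac)
  also have "\<dots> = poly (word_poly n c) x"
    using sum_rotate[of "\<lambda>i. c i * x ^ i" h n] by (simp add: poly_word_poly)
  finally show ?thesis .
qed

lemma cyclic_code_big_cyclic_shift:
  fixes A :: "'a::field set"
  assumes "n > 0" and "A \<subseteq> roots_of_unity n" and "c \<in> cyclic_code_big n A"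
  shows "cyclic_shift n h c \<in> cyclic_code_big n A"
proof -
  have "poly (word_poly n (cyclic_shift n h c)) x = 0" if "x \<in> A" for x
  proof -
    have "x \<in> roots_of_unity n"
      using assms(2) that by blast
    moreover have "poly (word_poly n c) x = 0"
      using assms that by (simp add: cyclic_code_big_eq_roots)
    ultimately show ?thesis
      using poly_word_poly_cyclic_shift[of x n h c] root_of_unity_neq_0[of x n] assms(1) by simp
  qed
  then show ?thesis
    using assms(1,2) by (simp add: cyclic_code_big_eq_roots cyclic_shift_in_words)
qed

lemma dual_code_subset_words: "dual_code n C \<subseteq> words n"
  by (auto simp: dual_code_def words_def)

lemma dual_code_diff: "v \<in> dual_code n C \<Longrightarrow> w \<in> dual_code n C \<Longrightarrow> v - w \<in> dual_code n C"
  by (simp add: dual_code_def left_diff_distrib sum_subtractf)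

lemma dual_code_cyclic_shift:
  assumes "C \<subseteq> words n" and shift: "\<And>c h. c \<in> C \<Longrightarrow> cyclic_shift n h c \<in> C"
    and "v \<in> dual_code n C"
  shows "cyclic_shift n h v \<in> dual_code n C"
proof -
  have "(\<Sum>i<n. cyclic_shift n h v i * c i) = 0" if "c \<in> C" for c
  proof (cases "n = 0")
    case False
    define c' where "c' = cyclic_shift n ((n - 1) * h) c"
    have "cyclic_shift n h c' = cyclic_shift n (n * h) c"
      using False mult_eq_if[of n h] by (simp add: c'_def cyclic_shift_cyclic_shift)
    also have "\<dots> = c"
      using assms(1) that by (intro cyclic_shift_multiple) auto
    finally have "cyclic_shift n h c' = c" .
    then have "(\<Sum>i<n. cyclic_shift n h v i * c i) = (\<Sum>i<n. v i * c' i)"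
      using sum_cyclic_shift_mult[of n h v c'] by simp
    also have "\<dots> = 0"
      using assms(3) shift[OF that] by (simp add: dual_code_def c'_def)
    finally show ?thesis .
  qed simp
  then show ?thesis
    using cyclic_shift_in_words[of n h v] by (simp add: dual_code_def words_def)
qed

lemma dual_code_min_weight_word_at:
  assumes "C \<subseteq> words n" and shift: "\<And>c h. c \<in> C \<Longrightarrow> cyclic_shift n h c \<in> C"
    and "v \<in> dual_code n C" and "v \<noteq> (\<lambda>_. 0)" and "l < n"
  obtains u where "u \<in> dual_code n C" and "l \<in> support n u"
    and "hamming_weight n u = min_dist n (dual_code n C)"
proof -
  have "(\<lambda>_. 0) \<in> dual_code n C"
    by (simp add: dual_code_def)
  then obtain u j where u: "u \<in> dual_code n C" "j \<in> support n u"
    "hamming_weight n u = min_dist n (dual_code n C)"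
    using min_weight_word[OF dual_code_subset_words dual_code_diff assms(3) _ assms(4)] by blast
  define u' where "u' = cyclic_shift n (j + n - l) u"
  have "u' \<in> dual_code n C"
    unfolding u'_def using assms(1) shift u(1) by (rule dual_code_cyclic_shift)
  moreover have "l \<in> support n u'"
    using u(2) assms(5) by (simp add: u'_def cyclic_shift_def support_def)
  moreover have "hamming_weight n u' = min_dist n (dual_code n C)"
    by (simp add: u'_def hamming_weight_cyclic_shift u(3))
  ultimately show ?thesis
    using that by blast
qed

text \<open>The twisted word \<open>\<lambda>i. x i * b ^ i\<close> vanishes on \<open>A\<close>, so it is orthogonal to \<open>u\<close>.\<close>
lemma poly_mult_dual_word_eq_0:
  fixes A :: "'a::field set"
  assumes "n > 0" and "A \<subseteq> roots_of_unity n" and "u \<in> dual_code n (cyclic_code_big n A)"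
    and roots: "\<And>a. a \<in> A \<Longrightarrow> poly (word_poly n x) (a * b) = 0"
  shows "poly (word_poly n (\<lambda>i. u i * x i)) b = 0"
proof -
  define y where "y = (\<lambda>i. if i < n then x i * b ^ i else 0)"
  have "poly (word_poly n y) a = poly (word_poly n x) (a * b)" for a
    by (simp add: poly_word_poly y_def power_mult_distrib mult_ac)
  then have "y \<in> cyclic_code_big n A"
    using assms(1,2) roots by (simp add: cyclic_code_big_eq_roots) (simp add: y_def words_def)
  then have "(\<Sum>i<n. u i * y i) = 0"
    using assms(3) by (simp add: dual_code_def)
  then show ?thesis
    by (simp add: poly_word_poly y_def mult_ac)
qed

lemma repair_set_support_dual_word:
  fixes A :: "'a::field set"
  assumes "n > 0" and "A \<subseteq> roots_of_unity n"
    and g: "primitive_root_of_unity n g" and "c \<noteq> 0"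
    and roots: "\<And>x z. x \<in> C \<Longrightarrow> z \<in> setprod A (geometric_set c g {..<\<delta> - 1}) \<Longrightarrow>
      poly (word_poly n x) z = 0"
    and u: "u \<in> dual_code n (cyclic_code_big n A)"
  shows "repair_set n C \<delta> (support n u)"
  unfolding repair_set_def
proof (intro conjI ballI impI)
  show "support n u \<subseteq> {..<n}"
    by (auto simp: support_def)
next
  fix x y
  assume xy: "x \<in> C" "y \<in> C" and "\<exists>j\<in>support n u. x j \<noteq> y j"
  then obtain l where l: "l \<in> support n u" "x l \<noteq> y l"
    by blast
  define z where "z = (\<lambda>i. u i * (x - y) i)"
  have "poly (word_poly n z) b = 0" if "b \<in> geometric_set c g {..<\<delta> - 1}" for b
    unfolding z_def
  proof (rule poly_mult_dual_word_eq_0[OF assms(1,2) u])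
    fix a
    assume "a \<in> A"
    then have "a * b \<in> setprod A (geometric_set c g {..<\<delta> - 1})"
      using that by (auto simp: setprod_def)
    then show "poly (word_poly n (x - y)) (a * b) = 0"
      using roots xy by (simp add: word_poly_diff)
  qed
  moreover have "l \<in> support n z"
    using l by (simp add: z_def support_def)
  ultimately have "\<delta> - 1 < hamming_weight n z"
    by (rule BCH_bound[OF g assms(4)])
  also have "support n z = {j \<in> support n u. x j \<noteq> y j}"
    by (auto simp: z_def support_def)
  then have "hamming_weight n z = card {j \<in> support n u. x j \<noteq> y j}"
    by (simp add: hamming_weight_def)
  finally show "\<delta> \<le> card {j \<in> support n u. x j \<noteq> y j}"
    by simp
qed

lemma is_LRC_if_repair_sets:
  assumes "\<delta> \<ge> 2" and "C \<subseteq> words n" and "x \<in> C" and "y \<in> C" and "x \<noteq> y"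
    and repair: "\<And>l. l < n \<Longrightarrow> \<exists>S. repair_set n C \<delta> S \<and> l \<in> S \<and> card S \<le> w"
  shows "is_LRC n C (int w - int \<delta> + 1) \<delta>"
proof -
  obtain l where l: "l < n" "x l \<noteq> y l"
    using words_neqE[OF assms(5,3,4,2)] .
  then obtain S where "repair_set n C \<delta> S" "l \<in> S" "card S \<le> w"
    using repair by blast
  then have "\<delta> \<le> w"
    using repair_set_card_ge[of n C \<delta> S x y l] assms(3,4) l(2) by linarith
  moreover have "has_locality n C (int w - int \<delta> + 1) \<delta> l" if "l < n" for l
    using repair[OF that] by (auto simp: has_locality_iff_repair_set)
  ultimately show ?thesis
    using assms(1) by (simp add: is_LRC_def)
qed

lemma is_LRC_from_dual_code:
  fixes A :: "'a::field set"
  assumes "n > 0" and "A \<subseteq> roots_of_unity n" and "A \<noteq> {}"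
    and g: "primitive_root_of_unity n g" and "c \<noteq> 0"
    and roots: "\<And>x z. x \<in> C \<Longrightarrow> z \<in> setprod A (geometric_set c g {..<\<delta> - 1}) \<Longrightarrow>
      poly (word_poly n x) z = 0"
    and "\<delta> \<ge> 2" and "C \<subseteq> words n" and "x \<in> C" and "y \<in> C" and "x \<noteq> y"
  shows "is_LRC n C (int (min_dist n (dual_code n (cyclic_code_big n A))) - int \<delta> + 1) \<delta>"
proof (rule is_LRC_if_repair_sets[OF assms(7-11)])
  fix l
  assume "l < n"
  obtain a where "a \<in> A"
    using assms(3) by auto
  define v where "v = (\<lambda>i. if i < n then a ^ i else 0)"
  note code = cyclic_code_big_eq_roots[OF assms(1,2)]
  have "v \<in> dual_code n (cyclic_code_big n A)"
    using \<open>a \<in> A\<close> by (auto simp: dual_code_def code poly_word_poly v_def mult.commute)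
  moreover have "v \<noteq> (\<lambda>_. 0)"
    using assms(1) by (auto simp: v_def fun_eq_iff intro: exI[of _ 0])
  moreover have "cyclic_code_big n A \<subseteq> words n"
    by (auto simp: code)
  ultimately obtain u where u: "u \<in> dual_code n (cyclic_code_big n A)" "l \<in> support n u"
    "hamming_weight n u = min_dist n (dual_code n (cyclic_code_big n A))"
    using dual_code_min_weight_word_at[OF _ cyclic_code_big_cyclic_shift[OF assms(1,2)]]
      \<open>l < n\<close> by blast
  have "repair_set n C \<delta> (support n u)"
    using assms(1,2) g assms(5) roots u(1) by (rule repair_set_support_dual_word)
  then show "\<exists>S. repair_set n C \<delta> S \<and> l \<in> S \<and>
      card S \<le> min_dist n (dual_code n (cyclic_code_big n A))"
    using u(2,3) by (auto simp: hamming_weight_def)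
qed

section \<open>The defining set\<close>

lemma setprod_geometric_set:
  fixes c d g :: "'a::comm_monoid_mult"
  shows "setprod (geometric_set c g E) (geometric_set d g E') = geometric_set (c * d) g (E + E')"
proof -
  have "setprod (geometric_set c g E) (geometric_set d g E') =
      {(c * g ^ e) * (d * g ^ e') | e e'. e \<in> E \<and> e' \<in> E'}"
    unfolding setprod_def geometric_set_def by blast
  also have "\<dots> = {(c * d) * g ^ (e + e') | e e'. e \<in> E \<and> e' \<in> E'}"
    by (simp add: power_add ac_simps)
  also have "\<dots> = geometric_set (c * d) g (E + E')"
    unfolding geometric_set_def set_plus_def by blast
  finally show ?thesis .
qed

lemma setA_eq_geometric_set:
  "setA \<alpha> t b m i s = geometric_set (\<alpha> ^ t) (\<alpha> ^ b) ({..<m} \<union> i ` {1..s})"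
  unfolding setA_def geometric_set_def
  by (auto simp: power_add mult.commute[of _ b] power_mult)

lemma setB_eq_geometric_set:
  assumes "\<alpha> \<noteq> 0" and "odd \<delta>" and "\<delta> \<ge> 3"
  shows "setB \<alpha> b \<delta> = geometric_set (inverse (\<alpha> ^ b) ^ ((\<delta> - 3) div 2)) (\<alpha> ^ b) {..<\<delta> - 1}"
proof -
  obtain h where h: "\<delta> = 2 * h + 3"
    using assms(2,3) by (auto elim!: oddE intro: that[of "(\<delta> - 3) div 2"])
  have shift: "{- int h..int h + 1} = (\<lambda>j. int j - int h) ` {..<2 * h + 2}"
  proof (intro equalityI subsetI)
    fix j
    assume "j \<in> {- int h..int h + 1}"
    then show "j \<in> (\<lambda>j. int j - int h) ` {..<2 * h + 2}"
      by (intro image_eqI[of _ _ "nat (j + int h)"]) auto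
  qed auto
  have power: "\<alpha> powi ((int j - int h) * int b) = inverse (\<alpha> ^ b) ^ h * (\<alpha> ^ b) ^ j" for j
  proof -
    have "\<alpha> powi ((int j - int h) * int b) = (\<alpha> ^ b) powi (int j - int h)"
      by (simp add: mult.commute[of _ "int b"] power_int_mult)
    also have "\<dots> = inverse (\<alpha> ^ b) ^ h * (\<alpha> ^ b) ^ j"
      using assms(1) by (simp add: power_int_diff field_simps)
    finally show ?thesis .
  qed
  have "setB \<alpha> b \<delta> = (\<lambda>j. \<alpha> powi (j * int b)) ` {- int h..int h + 1}"
    by (auto simp: setB_def h)
  also have "\<dots> = geometric_set (inverse (\<alpha> ^ b) ^ h) (\<alpha> ^ b) {..<2 * h + 2}"
    by (simp add: shift image_image power geometric_set_def)
  finally show ?thesis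
    by (simp add: h)
qed

definition spaced_runs :: "nat \<Rightarrow> (nat \<Rightarrow> nat) \<Rightarrow> nat \<Rightarrow> nat \<Rightarrow> nat set" where
  "spaced_runs m i s d = {..<m + d - 1} \<union> (\<Union>l\<in>{1..s}. {i l..<i l + d})"

lemma plus_lessThan_eq_spaced_runs:
  assumes "m > 0" and "d > 0"
  shows "({..<m} \<union> i ` {1..s}) + {..<d} = spaced_runs m i s d"
proof (rule set_eqI)
  fix x
  have "(\<exists>e<m. \<exists>j<d. x = e + j) \<longleftrightarrow> x < m + d - 1"
  proof
    assume "x < m + d - 1"
    then have "min x (m - 1) < m" "x - min x (m - 1) < d" "x = min x (m - 1) + (x - min x (m - 1))"
      using assms by auto
    then show "\<exists>e<m. \<exists>j<d. x = e + j"
      by blast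
  qed auto
  moreover have "(\<exists>j<d. x = a + j) \<longleftrightarrow> a \<le> x \<and> x < a + d" for a
    by (auto intro: exI[of _ "x - a"])
  ultimately show "x \<in> ({..<m} \<union> i ` {1..s}) + {..<d} \<longleftrightarrow> x \<in> spaced_runs m i s d"
    by (simp add: set_plus_def spaced_runs_def bex_Un) blast
qed

lemma spaced_runs_subset_and_card:
  assumes "m > 0" and "m - 1 + d \<le> i 1"
    and "s \<ge> 1" and "\<forall>l. 1 \<le> l \<and> l < s \<longrightarrow> i l + d \<le> i (l + 1)"
  shows "spaced_runs m i s d \<subseteq> {..<i s + d} \<and> card (spaced_runs m i s d) = m - 1 + (s + 1) * d"
  using assms(3,4)
proof (induction s rule: nat_induct_at_least)
  case base
  have "spaced_runs m i 1 d = {..<m - 1 + d} \<union> {i 1..<i 1 + d}"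
    using assms(1) by (simp add: spaced_runs_def)
  moreover have "card ({..<m - 1 + d} \<union> {i 1..<i 1 + d}) = m - 1 + (1 + 1) * d"
    using assms(2) by (subst card_Un_disjoint) auto
  ultimately show ?case
    using assms(2) by auto
next
  case (Suc s)
  then have IH: "spaced_runs m i s d \<subseteq> {..<i s + d}"
      "card (spaced_runs m i s d) = m - 1 + (s + 1) * d"
    and gap: "i s + d \<le> i (Suc s)"
    by auto
  have split: "spaced_runs m i (Suc s) d = spaced_runs m i s d \<union> {i (Suc s)..<i (Suc s) + d}"
    by (simp add: spaced_runs_def atLeastAtMostSuc_conv Un_ac)
  have "card (spaced_runs m i (Suc s) d) = card (spaced_runs m i s d) + d"
    unfolding split using IH(1) gap
    by (subst card_Un_disjoint) (auto intro: finite_subset)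
  then show ?case
    using IH gap by (auto simp: split)
qed

section \<open>Cyclic codes with spaced defining sets\<close>

locale spaced_defining_set = quadratic_finite_field q field_type
  for q :: nat and field_type :: "'a::{finite, field} itself" +
  fixes n b s m t \<delta> :: nat and i :: "nat \<Rightarrow> nat" and \<alpha> :: 'a
  assumes primitive: "primitive_root_of_unity n \<alpha>" and coprime_b_n: "coprime b n"
    and delta_odd: "odd \<delta>" and delta_ge_3: "\<delta> \<ge> 3" and s_pos: "s > 0" and m_pos: "m > 0"
    and start_bound: "m - 1 + \<delta> \<le> i 1" and end_bound: "i s + \<delta> \<le> n"
    and gaps: "\<forall>l. 1 \<le> l \<and> l < s \<longrightarrow> i (l + 1) \<ge> i l + \<delta>"
    and cosets: "union_of_cyclotomic_cosets q n \<alpha> (setprod (setA \<alpha> t b m i s) (setB \<alpha> b \<delta>))"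
begin

abbreviation A :: "'a set" where "A \<equiv> setA \<alpha> t b m i s"
abbreviation B :: "'a set" where "B \<equiv> setB \<alpha> b \<delta>"
abbreviation Z :: "'a set" where "Z \<equiv> setprod A B"
abbreviation C :: "(nat \<Rightarrow> 'a) set" where "C \<equiv> cyclic_code_Fq q n Z"
abbreviation k :: nat where "k \<equiv> n + 1 - m - (s + 1) * (\<delta> - 1)"
abbreviation r :: int where "r \<equiv> int (min_dist n (dual_code n (cyclic_code_big n A))) - int \<delta> + 1"

definition g :: 'a where "g = \<alpha> ^ b"
definition first_B :: 'a where "first_B = inverse g ^ ((\<delta> - 3) div 2)"

lemma n_pos: "n > 0"
  using end_bound delta_ge_3 by simp

lemma alpha_root_of_unity: "\<alpha> \<in> roots_of_unity n"
  using primitive by (rule primitive_root_in_roots_of_unity)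

lemma primitive_g: "primitive_root_of_unity n g"
  unfolding g_def using primitive n_pos coprime_b_n by (rule primitive_root_power_coprime)

lemma g_root_of_unity: "g \<in> roots_of_unity n"
  using primitive_g by (rule primitive_root_in_roots_of_unity)

lemma first_B_root_of_unity: "first_B \<in> roots_of_unity n"
  unfolding first_B_def by (intro power_in_roots_of_unity inverse_in_roots_of_unity g_root_of_unity)

lemma first_B_neq_0: "first_B \<noteq> 0"
  using first_B_root_of_unity n_pos by (rule root_of_unity_neq_0)

lemma first_Z_root_of_unity: "\<alpha> ^ t * first_B \<in> roots_of_unity n"
  using power_in_roots_of_unity[OF alpha_root_of_unity] first_B_root_of_unity
  by (rule mult_in_roots_of_unity)

lemma first_Z_neq_0: "\<alpha> ^ t * first_B \<noteq> 0"
  using first_Z_root_of_unity n_pos by (rule root_of_unity_neq_0)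

lemma A_eq: "A = geometric_set (\<alpha> ^ t) g ({..<m} \<union> i ` {1..s})"
  by (simp add: setA_eq_geometric_set g_def)

lemma B_eq: "B = geometric_set first_B g {..<\<delta> - 1}"
  using setB_eq_geometric_set[OF _ delta_odd delta_ge_3]
    root_of_unity_neq_0[OF alpha_root_of_unity n_pos]
  by (simp add: first_B_def g_def)

lemma Z_eq: "Z = geometric_set (\<alpha> ^ t * first_B) g (spaced_runs m i s (\<delta> - 1))"
  using plus_lessThan_eq_spaced_runs[of m "\<delta> - 1" i s] m_pos delta_ge_3
  by (simp add: A_eq B_eq setprod_geometric_set)

lemma card_Z: "card Z = m - 1 + (s + 1) * (\<delta> - 1)" and card_Z_less: "card Z < n"
proof -
  let ?E = "spaced_runs m i s (\<delta> - 1)"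
  have "m - 1 + (\<delta> - 1) \<le> i 1"
    using start_bound by linarith
  moreover have "\<forall>l. 1 \<le> l \<and> l < s \<longrightarrow> i l + (\<delta> - 1) \<le> i (l + 1)"
    using gaps by (auto intro: order_trans[rotated])
  ultimately have E: "?E \<subseteq> {..<i s + (\<delta> - 1)}" "card ?E = m - 1 + (s + 1) * (\<delta> - 1)"
    using spaced_runs_subset_and_card[of m "\<delta> - 1" i s] m_pos s_pos by auto
  have bound: "i s + (\<delta> - 1) < n"
    using end_bound delta_ge_3 by linarith
  with E(1) have "?E \<subseteq> {..<n}"
    by auto
  then have "card Z = card ?E"
    unfolding Z_eq
    by (rule card_geometric_set[OF primitive_g n_pos first_Z_neq_0])
  moreover have "card ?E \<le> i s + (\<delta> - 1)"
    using card_mono[OF _ E(1)] by simp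
  ultimately show "card Z = m - 1 + (s + 1) * (\<delta> - 1)" and "card Z < n"
    using E(2) bound by simp_all
qed

sublocale Fq_cyclic_code q field_type n Z
proof
  show "n > 0"
    by (rule n_pos)
  show Z_roots: "Z \<subseteq> roots_of_unity n"
    unfolding Z_eq
    using first_Z_root_of_unity g_root_of_unity by (rule geometric_set_subset_roots_of_unity)
  show "x ^ q \<in> Z" if "x \<in> Z" for x
    using primitive n_pos cosets Z_roots that by (rule union_of_cyclotomic_cosets_power_closed)
qed

lemma card_code: "card C = q ^ k"
proof -
  have "k = n - card Z"
    using card_Z m_pos by simp
  then show ?thesis
    using card_cyclic_code_Fq card_Z_less by simp
qed

lemma k_pos: "k > 0"
  using card_Z card_Z_less m_pos by simp

lemma code_nontrivial: obtains x y where "x \<in> C" and "y \<in> C" and "x \<noteq> y"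
proof -
  have "card C > 1"
    unfolding card_code using q_gt_1 k_pos by (rule one_less_power)
  then have "\<not> is_singleton C" and "C \<noteq> {}"
    by (auto simp: is_singleton_altdef)
  then show ?thesis
    using that by (meson is_singletonI')
qed

lemma code_subset_words: "C \<subseteq> words n"
  by (auto simp: mem_cyclic_code_Fq_iff)

lemma is_LRC_code: "is_LRC n C r \<delta>"
proof -
  obtain x y where xy: "x \<in> C" "y \<in> C" "x \<noteq> y"
    by (rule code_nontrivial)
  have "A \<subseteq> roots_of_unity n"
    unfolding A_eq
    using power_in_roots_of_unity[OF alpha_root_of_unity] g_root_of_unity
    by (rule geometric_set_subset_roots_of_unity)
  moreover have "A \<noteq> {}" and "\<delta> \<ge> 2"
    using m_pos delta_ge_3 by (auto simp: A_eq geometric_set_def)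
  moreover have "poly (word_poly n c) z = 0"
    if "c \<in> C" "z \<in> setprod A (geometric_set first_B g {..<\<delta> - 1})" for c z
    using that unfolding B_eq[symmetric] mem_cyclic_code_Fq_iff by blast
  ultimately show ?thesis
    using is_LRC_from_dual_code[OF n_pos _ _ primitive_g first_B_neq_0
        _ _ code_subset_words xy] by blast
qed

lemma min_dist_code_ge: "m + \<delta> - 1 \<le> min_dist n C"
proof -
  obtain x y where xy: "x \<in> C" "y \<in> C" "x \<noteq> y"
    by (rule code_nontrivial)
  have "geometric_set (\<alpha> ^ t * first_B) g {..<m + \<delta> - 2} \<subseteq> Z"
    unfolding Z_eq geometric_set_def by (intro image_mono) (auto simp: spaced_runs_def)
  then have "m + \<delta> - 2 < min_dist n C"
    using xy by (rule BCH_min_dist[OF primitive_g first_Z_neq_0])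
  then show ?thesis
    by linarith
qed

lemma optimal_code:
  assumes "\<lceil>real k / real_of_int r\<rceil> = int s + 1"
  shows "optimal_LRC n k C r \<delta>" and "min_dist n C = m + \<delta> - 1"
proof -
  have "n = k + (m - 1) + (s + 1) * (\<delta> - 1)"
    using card_Z card_Z_less m_pos by linarith
  then have "int n - int k = int (m - 1) + int ((s + 1) * (\<delta> - 1))"
    by linarith
  also have "int ((s + 1) * (\<delta> - 1)) = (int s + 1) * (int \<delta> - 1)"
    unfolding of_nat_mult using delta_ge_3 by simp
  finally have bound:
    "int n - int k - (\<lceil>real k / real_of_int r\<rceil> - 1) * (int \<delta> - 1) + 1 = int (m + \<delta> - 1)"
    unfolding assms using m_pos delta_ge_3 by (simp add: algebra_simps)
  have "undetermined_below C k"
    by (rule undetermined_below_if_card_eq_power[of "subfield_Fq q"])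
      (use q_gt_1 card_code in \<open>simp_all add: card_subfield_Fq mem_cyclic_code_Fq_iff\<close>)
  then have "int (min_dist n C) \<le> int (m + \<delta> - 1)"
    unfolding bound[symmetric] using k_pos
    by (rule LRC_singleton_bound[OF is_LRC_code code_subset_words])
  then show min_dist: "min_dist n C = m + \<delta> - 1"
    using min_dist_code_ge by linarith
  show "optimal_LRC n k C r \<delta>"
    unfolding optimal_LRC_def min_dist bound using is_LRC_code by simp
qed

end

theorem theorem5p4:
  fixes q n b s m t \<delta> :: nat
    and i :: "nat \<Rightarrow> nat"
    and \<alpha> :: "'a::{finite, field}"
  assumes "prime_power q"
    and "card (UNIV :: 'a set) = q ^ 2"
    and "n dvd q + 1"
    and "primitive_root_of_unity n \<alpha>"
    and "odd \<delta>" and "\<delta> \<ge> 3"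
    and "b > 0" and "s > 0" and "m > 0"
    and "gcd b n = 1"
    and "t < n"
    and "m - 1 + \<delta> \<le> i 1"
    and "i s + \<delta> \<le> n"
    and "\<forall>l. 1 \<le> l \<and> l < s \<longrightarrow> i (l + 1) \<ge> i l + \<delta>"
  defines "k \<equiv> n + 1 - m - (s + 1) * (\<delta> - 1)"
    and "r \<equiv> int (min_dist n (dual_code n (cyclic_code_big n (setA \<alpha> t b m i s)))) - int \<delta> + 1"
  assumes "union_of_cyclotomic_cosets q n \<alpha> (setprod (setA \<alpha> t b m i s) (setB \<alpha> b \<delta>))"
  shows "is_LRC n (cyclic_code_Fq q n (setprod (setA \<alpha> t b m i s) (setB \<alpha> b \<delta>))) r \<delta>
       \<and> card (cyclic_code_Fq q n (setprod (setA \<alpha> t b m i s) (setB \<alpha> b \<delta>))) = q ^ k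
       \<and> (\<lceil>real k / real_of_int r\<rceil> = int s + 1 \<longrightarrow>
            optimal_LRC n k (cyclic_code_Fq q n (setprod (setA \<alpha> t b m i s) (setB \<alpha> b \<delta>))) r \<delta>
            \<and> min_dist n (cyclic_code_Fq q n (setprod (setA \<alpha> t b m i s) (setB \<alpha> b \<delta>))) = m + \<delta> - 1)"
proof -
  interpret spaced_defining_set q "TYPE('a)" n b s m t \<delta> i \<alpha>
    using assms by unfold_locales (auto simp: coprime_iff_gcd_eq_1)
  show ?thesis
    unfolding k_def r_def using is_LRC_code card_code optimal_code by blast
qed

end
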